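(* Let $k$ be a positive integer and let $(P_{k,n})_{n\ge 0}$ be the $k$-Pell sequence. Then for every positive integer $n$: (1) $P_{k,n+1}^2+kP_{k,n}^2=P_{k,2n+1}$, and (2) $P_{k,n+1}^2-k^2P_{k,n-1}^2=2P_{k,2n}$.
   Context: For a positive integer $k$, the $k$-Pell sequence $(P_{k,n})_{n\ge 0}$ is defined by $P_{k,0}=0$, $P_{k,1}=1$ and $P_{k,n}=2P_{k,n-1}+kP_{k,n-2}$ for $n\ge 2$. *)

theory Defs
  imports Main
begin

(* The values are integers, so that the subtraction of terms is not truncated. *)
fun kpell :: "int \<Rightarrow> nat \<Rightarrow> int" where
  "kpell k 0 = 0"
| "kpell k (Suc 0) = 1"
| "kpell k (Suc (Suc n)) = 2 * kpell k (Suc n) + k * kpell k n"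

end

theory Submission
  imports Defs
begin

text \<open>
  Both identities are diagonal cases of the addition formula
  \<open>P (m + n + 1) = P (m + 1) * P (n + 1) + k * P m * P n\<close>. Taking \<open>m = n\<close> gives the sum of
  squares. Taking \<open>m = n - 1\<close> gives \<open>P (2 * n) = P n * (P (n + 1) + k * P (n - 1))\<close>, and since
  the recurrence says \<open>2 * P n = P (n + 1) - k * P (n - 1)\<close>, the double of this is the
  difference of squares.
\<close>

text \<open>
  One application of the recurrence moves an index step from \<open>n\<close> to \<open>m\<close> without changing the
  right-hand side, so induction on \<open>m\<close> works once \<open>n\<close> is arbitrary.
\<close>

lemma kpell_add:
  "kpell k (Suc (m + n)) = kpell k (Suc m) * kpell k (Suc n) + k * kpell k m * kpell k n"
proof (induction m arbitrary: n)
  case 0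
  show ?case by simp
next
  case (Suc m)
  have "kpell k (Suc (Suc m + n)) = kpell k (Suc (m + Suc n))" by simp
  also have "\<dots> = kpell k (Suc m) * kpell k (Suc (Suc n)) + k * kpell k m * kpell k (Suc n)"
    by (rule Suc.IH)
  also have "\<dots> = kpell k (Suc (Suc m)) * kpell k (Suc n) + k * kpell k (Suc m) * kpell k n"
    by (simp add: algebra_simps)
  finally show ?case .
qed

theorem theorem4p6:
  fixes k :: int and n :: nat
  assumes "k > 0" and "n > 0"
  shows "(kpell k (n + 1))\<^sup>2 + k * (kpell k n)\<^sup>2 = kpell k (2 * n + 1) \<and>
         (kpell k (n + 1))\<^sup>2 - k\<^sup>2 * (kpell k (n - 1))\<^sup>2 = 2 * kpell k (2 * n)"
proof
  show "(kpell k (n + 1))\<^sup>2 + k * (kpell k n)\<^sup>2 = kpell k (2 * n + 1)"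
    using kpell_add[of k n n] by (simp add: mult_2 power2_eq_square)
next
  obtain m where n: "n = Suc m" using \<open>n > 0\<close> by (cases n) auto
  have double: "kpell k (2 * n) = kpell k n * kpell k (Suc n) + k * kpell k m * kpell k n"
    using kpell_add[of k m n] by (simp add: n mult_2 del: kpell.simps(3))
  have rec: "2 * kpell k n = kpell k (Suc n) - k * kpell k m"
    by (simp add: n)
  have "(kpell k (Suc n))\<^sup>2 - k\<^sup>2 * (kpell k m)\<^sup>2
      = (kpell k (Suc n) - k * kpell k m) * (kpell k (Suc n) + k * kpell k m)"
    by (simp add: algebra_simps power2_eq_square)
  also have "\<dots> = 2 * kpell k (2 * n)"
    unfolding rec[symmetric] double by (simp add: algebra_simps)
  finally show "(kpell k (n + 1))\<^sup>2 - k\<^sup>2 * (kpell k (n - 1))\<^sup>2 = 2 * kpell k (2 * n)"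
    by (simp add: n)
qed

end
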